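(* Suppose the standing assumptions on (P) and on the core function $K$ listed in the context hold, and let $\{(u^k,p^k)\}$ be generated by VAPP with a parameter sequence $\{\epsilon^k\}$ satisfying $0<\underline{\epsilon}\le\epsilon^{k+1}\le\epsilon^k\le\overline{\epsilon}<\beta/(B_G+B_\Omega+\gamma\tau^2)$ for all $k$. Let $(u^*,p^* )$ be a saddle point of $L$ over $\mathbf U\times\mathbf C^*$, and let $M_0$ be a bound on the dual optimal solutions of (P), i.e. every maximizer $p$ of $\psi$ over $\mathbf C^*$ satisfies $\|p\|\le M_0$. For an integer $t>0$ put $$\bar u_t=\frac{\sum_{k=0}^t\epsilon^k u^{k+1}}{\sum_{k=0}^t\epsilon^k},\qquad \bar p_t=\frac{\sum_{k=0}^t\epsilon^k q^{k}}{\sum_{k=0}^t\epsilon^k}.$$ Then for every integer $t>0$, $(\bar u_t,\bar p_t)\in\mathbf U\times\mathbf C^*$ and: (i) for all $(u,p)\in\mathbf U\times\mathbf C^*$, $$L(\bar u_t,p)-L(u,\bar p_t)\le\frac{D(u,u^0)+\frac{\epsilon^0}{2\gamma}\|p-p^0\|^2}{\underline{\epsilon}(t+1)};$$ (ii) $\displaystyle\|\Pi(\Theta(\bar u_t))\|\le\frac{d_1}{\underline{\epsilon}(t+1)}$, where $d_1=\max_{\|p\|\le M_0+1}\big[D(u^*,u^0)+\frac{\epsilon^0}{2\gamma}\|p-p^0\|^2\big]$; (iii) $\displaystyle-\frac{M_0d_1}{\underline{\epsilon}(t+1)}\le(G+J)(\bar u_t)-(G+J)(u^* )\le\frac{d_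1}{\underline{\epsilon}(t+1)}$.
   Context: Norms are Euclidean. $\mathbf U\subset\mathbb R^n$ is a nonempty closed convex set; $\mathbf C\subset\mathbb R^m$ is a nonempty closed convex cone with vertex at the origin; $\mathbf C^*=\{y:\langle y,x\rangle\ge0\ \forall x\in\mathbf C\}$. Problem (P): minimize $G(u)+J(u)$ subject to $\Theta(u)=\Omega(u)+\Phi(u)\in-\mathbf C$, $u\in\mathbf U$, where $\Omega,\Phi$ map into $\mathbb R^m$. Lagrangian: $L(u,p)=(G+J)(u)+\langle p,\Theta(u)\rangle$. A saddle point of $L$ over $\mathbf U\times\mathbf C^*$ is $(u^*,p^* )\in\mathbf U\times\mathbf C^*$ with $L(u^*,p)\le L(u^*,p^* )\le L(u,p^* )$ for all $u\in\mathbf U,p\in\mathbf C^*$. Dual function: $\psi(p)=\min_{u\in\mathbf U}L(u,p)$; the dual problem maximizes $\psi$ over $\mathbf C^*$. Standing assumptions on (P): (H1) $J$ is a convex l.s.c. function (not necessarily differentiable) with $\operatorname{dom}J\cap\mathbf U\ne\emptyset$. (H2) $G$ is convex and differentiable, with derivative Lipschitz with constant $B_G$. (H3) $\Omega$ and $\Phi$ are $\mathbf C$-convex on $\mathbf U$, where $F$ is $\mathbf C$-convex if $F(\alpha u+(1-\alpha)v)-\alpha F(u)-(1-\alpha)F(v)\in-\mathbf C$ for all $u,v\in\mathbf U$, $\alpha\in[0,1]$. (H4) $\Omega$ is differentiable and for every $p\in\mathbb R^m$ the function $f_p(u)=\langle p,\Omega(u)\rangle$ satisfies $\|\nabla f_p(u)-\nabla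 f_p(v)\|\le B_\Omega\|u-v\|$ for all $u,v\in\mathbf U$, with $B_\Omega$ independent of $p$. (H5) $\Theta$ is Lipschitz with constant $\tau$ on an open set containing $\mathbf U$. (H6) If the interior $\mathring{\mathbf C}\neq\emptyset$, then $\Theta(\mathbf U)\cap(-\mathring{\mathbf C})\ne\emptyset$; if $\mathbf C=\{0\}$, then $0$ is in the interior of $\Theta(\mathbf U)$. (H7) $L$ has at least one saddle point over $\mathbf U\times\mathbf C^*$. Assumption on the core function: $K$ is strongly convex with parameter $\beta>0$ and differentiable with gradient Lipschitz with constant $B$ on $\mathbf U$. Put $D(u,v)=K(u)-K(v)-\langle\nabla K(v),u-v\rangle$. $\Pi$ denotes the Euclidean projection onto $\mathbf C^*$. VAPP: fix $\gamma>0$, positive parameters $\epsilon^k$, $u^0\in\mathbf U$, $p^0\in\mathbf C^*$. For $k=0,1,\dots$, with $q^k=\Pi(p^k+\gamma\Theta(u^k))$, set $$u^{k+1}=\arg\min_{u\in\mathbf U}\langle\nabla G(u^k),u\rangle+J(u)+\langle q^k,\nabla\Omega(u^k)u+\Phi(u)\rangle+\tfrac1{\epsilon^k}D(u,u^k),\qquad p^{k+1}=\Pi(p^k+\gamma\Theta(u^{k+1})).$$ *)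

theory Defs
  imports "HOL-Analysis.Analysis"
begin

definition grad :: "('a::real_inner \<Rightarrow> real) \<Rightarrow> 'a \<Rightarrow> 'a" where
  "grad f x = (SOME g. GDERIV f x :> g)"

(* Convexity of a function with values in (-\<infinity>, \<infinity>]; only used together with
   the exclusion of -\<infinity>, so the right-hand side is never \<infinity> - \<infinity>. *)
definition ereal_convex :: "('a::real_vector \<Rightarrow> ereal) \<Rightarrow> bool" where
  "ereal_convex f \<longleftrightarrow>
     (\<forall>x y. \<forall>\<alpha>\<in>{0..1}. f (\<alpha> *\<^sub>R x + (1 - \<alpha>) *\<^sub>R y) \<le> ereal \<alpha> * f x + ereal (1 - \<alpha>) * f y)"

definition lower_semicontinuous :: "('a::topological_space \<Rightarrow> ereal) \<Rightarrow> bool" where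
  "lower_semicontinuous f \<longleftrightarrow> (\<forall>x. f x \<le> Liminf (at x) f)"

definition strongly_convex_on :: "real \<Rightarrow> 'a::real_normed_vector set \<Rightarrow> ('a \<Rightarrow> real) \<Rightarrow> bool" where
  "strongly_convex_on \<beta> S f \<longleftrightarrow>
     (\<forall>x\<in>S. \<forall>y\<in>S. \<forall>\<alpha>\<in>{0..1}.
        f (\<alpha> *\<^sub>R x + (1 - \<alpha>) *\<^sub>R y)
          \<le> \<alpha> * f x + (1 - \<alpha>) * f y - \<beta> / 2 * \<alpha> * (1 - \<alpha>) * (norm (x - y))\<^sup>2)"

definition dual_cone :: "'a::real_inner set \<Rightarrow> 'a set" where
  "dual_cone C = {y. \<forall>x\<in>C. 0 \<le> y \<bullet> x}"

definition cone_convex_on ::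
    "'b::real_vector set \<Rightarrow> 'a::real_vector set \<Rightarrow> ('a \<Rightarrow> 'b) \<Rightarrow> bool" where
  "cone_convex_on C S F \<longleftrightarrow>
     (\<forall>u\<in>S. \<forall>v\<in>S. \<forall>\<alpha>\<in>{0..1}.
        F (\<alpha> *\<^sub>R u + (1 - \<alpha>) *\<^sub>R v) - \<alpha> *\<^sub>R F u - (1 - \<alpha>) *\<^sub>R F v \<in> uminus ` C)"

definition objective :: "('a \<Rightarrow> real) \<Rightarrow> ('a \<Rightarrow> ereal) \<Rightarrow> 'a \<Rightarrow> ereal" where
  "objective G J u = ereal (G u) + J u"

definition lagrangian ::
    "('a \<Rightarrow> real) \<Rightarrow> ('a \<Rightarrow> ereal) \<Rightarrow> ('a \<Rightarrow> 'b::real_inner) \<Rightarrow> 'a \<Rightarrow> 'b \<Rightarrow> ereal" where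
  "lagrangian G J \<Theta> u p = objective G J u + ereal (p \<bullet> \<Theta> u)"

definition saddle_point :: "('a \<Rightarrow> 'b \<Rightarrow> ereal) \<Rightarrow> 'a set \<Rightarrow> 'b set \<Rightarrow> 'a \<Rightarrow> 'b \<Rightarrow> bool" where
  "saddle_point L U P u' p' \<longleftrightarrow>
     u' \<in> U \<and> p' \<in> P \<and> (\<forall>u\<in>U. \<forall>p\<in>P. L u' p \<le> L u' p' \<and> L u' p' \<le> L u p')"

definition dual_function :: "('a \<Rightarrow> 'b \<Rightarrow> ereal) \<Rightarrow> 'a set \<Rightarrow> 'b \<Rightarrow> ereal" where
  "dual_function L U p = (INF u\<in>U. L u p)"

definition bregman :: "('a::real_inner \<Rightarrow> real) \<Rightarrow> 'a \<Rightarrow> 'a \<Rightarrow> real" where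
  "bregman K u v = K u - K v - grad K v \<bullet> (u - v)"

definition weighted_mean :: "(nat \<Rightarrow> real) \<Rightarrow> (nat \<Rightarrow> 'a::real_vector) \<Rightarrow> nat \<Rightarrow> 'a" where
  "weighted_mean w x t = (\<Sum>k=0..t. w k *\<^sub>R x k) /\<^sub>R (\<Sum>k=0..t. w k)"

(* The function minimised over U in the primal step, at the current point v with multiplier q. *)
definition vapp_subproblem ::
    "('a::real_inner \<Rightarrow> real) \<Rightarrow> ('a \<Rightarrow> ereal) \<Rightarrow> ('a \<Rightarrow> 'b::real_inner) \<Rightarrow> ('a \<Rightarrow> 'b)
      \<Rightarrow> ('a \<Rightarrow> real) \<Rightarrow> real \<Rightarrow> 'a \<Rightarrow> 'b \<Rightarrow> 'a \<Rightarrow> ereal" where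
  "vapp_subproblem G J \<Omega> \<Phi> K e v q u =
     ereal (grad G v \<bullet> u) + J u
       + ereal (q \<bullet> (frechet_derivative \<Omega> (at v) u + \<Phi> u))
       + ereal (1 / e * bregman K u v)"

definition vapp_dual_step ::
    "('b::euclidean_space) set \<Rightarrow> ('a \<Rightarrow> 'b) \<Rightarrow> real \<Rightarrow> 'b \<Rightarrow> 'a \<Rightarrow> 'b" where
  "vapp_dual_step C \<Theta> \<gamma> p u = closest_point (dual_cone C) (p + \<gamma> *\<^sub>R \<Theta> u)"

definition vapp_sequence ::
    "('a::euclidean_space) set \<Rightarrow> ('b::euclidean_space) set \<Rightarrow> ('a \<Rightarrow> real) \<Rightarrow> ('a \<Rightarrow> ereal)
      \<Rightarrow> ('a \<Rightarrow> 'b) \<Rightarrow> ('a \<Rightarrow> 'b) \<Rightarrow> ('a \<Rightarrow> real) \<Rightarrow> real \<Rightarrow> (nat \<Rightarrow> real)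
      \<Rightarrow> (nat \<Rightarrow> 'a) \<Rightarrow> (nat \<Rightarrow> 'b) \<Rightarrow> (nat \<Rightarrow> 'b) \<Rightarrow> bool" where
  "vapp_sequence U C G J \<Omega> \<Phi> K \<gamma> \<epsilon> u p q \<longleftrightarrow>
     u 0 \<in> U \<and> p 0 \<in> dual_cone C \<and>
     (\<forall>k. q k = vapp_dual_step C (\<lambda>v. \<Omega> v + \<Phi> v) \<gamma> (p k) (u k) \<and>
          is_arg_min (vapp_subproblem G J \<Omega> \<Phi> K (\<epsilon> k) (u k) (q k)) (\<lambda>v. v \<in> U) (u (Suc k)) \<and>
          p (Suc k) = vapp_dual_step C (\<lambda>v. \<Omega> v + \<Phi> v) \<gamma> (p k) (u (Suc k)))"

end

theory Submission
  imports Defs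
begin

text \<open>
  Each iteration is a linearised proximal step in the primal variable followed by an extragradient
  step in the dual variable, and each half has a one-line energy estimate. Write \<open>x = u\<^sup>k\<^sup>+\<^sup>1\<close>
  and \<open>a = u\<^sup>k\<close>.

  \<^item> In the primal step, optimality of \<open>x\<close> and the three-point identity for the Bregman distance
  \<open>D\<close> bound \<open>\<epsilon>\<^sup>k (L(x, q\<^sup>k) - L(v, q\<^sup>k))\<close> by \<open>D(v, a) - D(v, x)\<close>, up to a term in
  \<open>\<parallel>x - a\<parallel>\<^sup>2\<close>: linearising the smooth part costs \<open>\<epsilon>\<^sup>k (B\<^sub>G + B\<^sub>\<Omega>) / 2\<close> of it and strong
  convexity of \<open>K\<close> pays back \<open>\<beta> / 2\<close> (\<open>linearised_proximal_step\<close>).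

  \<^item> In the dual step, \<open>q\<^sup>k\<close> is a predictor for \<open>p\<^sup>k\<^sup>+\<^sup>1\<close>. Two projection inequalities bound
  \<open>\<epsilon>\<^sup>k \<langle>y - q\<^sup>k, \<Theta>(x)\<rangle>\<close> by a difference of squared distances of \<open>y\<close> to the dual iterates, and
  the prediction error costs another \<open>\<epsilon>\<^sup>k \<gamma> \<tau>\<^sup>2 / 2\<close> of \<open>\<parallel>x - a\<parallel>\<^sup>2\<close> (\<open>extragradient_step\<close>).

  The step size condition guarantees that \<open>\<beta>\<close> covers all these costs, so the sum of the two
  estimates bounds \<open>\<epsilon>\<^sup>k (L(x, y) - L(v, q\<^sup>k))\<close> by differences of nonnegative quantities
  (\<open>vapp_iteration\<close>). These telescope because \<open>\<epsilon>\<^sup>k\<close> decreases; since \<open>L\<close> is convex in its first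
  argument and affine in its second, the averages inherit the bound, which is the first claim
  (\<open>ergodic_saddle_gap\<close>).

  The other claims come from testing the gap at \<open>v = u\<^sup>*\<close> with well-chosen multipliers
  (\<open>gap_imp_residual_and_value_bounds\<close>): \<open>p\<^sup>*\<close> plus the unit vector along \<open>\<Pi>(\<Theta>(z))\<close> detects the
  constraint violation of the average \<open>z\<close>, and \<open>0\<close> gives the upper bound on the objective. The
  lower bound is the saddle inequality at \<open>p\<^sup>*\<close> combined with the violation bound. All these
  multipliers have norm at most \<open>M\<^sub>0 + 1\<close>, since \<open>p\<^sup>*\<close> maximises the dual function.

  The extended-real function \<open>J\<close> matters only on \<open>V = U \<inter> dom J\<close>, a convex set that contains
  \<open>u\<^sup>*\<close> and every iterate after the first. The estimates are therefore proved for a real-valued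
  convex function on \<open>V\<close>; only the starting point may lie outside \<open>V\<close>, so comparison points are
  taken in \<open>V\<close> and linearisation points in \<open>U\<close>.
\<close>

section \<open>Gradients and Bregman distances\<close>

lemma gderiv_grad:
  fixes f :: "'a::euclidean_space \<Rightarrow> real"
  assumes "f differentiable (at x)"
  shows "GDERIV f x :> grad f x"
proof -
  from assms obtain f' where f': "(f has_derivative f') (at x)"
    by (auto simp: differentiable_def)
  interpret f': bounded_linear f' by (rule has_derivative_bounded_linear[OF f'])
  have "f' h = h \<bullet> (\<Sum>b\<in>Basis. f' b *\<^sub>R b)" for h
  proof -
    have "f' h = f' (\<Sum>b\<in>Basis. (h \<bullet> b) *\<^sub>R b)" by (simp add: euclidean_representation)
    also have "\<dots> = (\<Sum>b\<in>Basis. (h \<bullet> b) * f' b)" by (simp add: f'.sum f'.scaleR)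
    also have "\<dots> = h \<bullet> (\<Sum>b\<in>Basis. f' b *\<^sub>R b)"
      by (simp add: inner_sum_right mult.commute)
    finally show ?thesis .
  qed
  then have "f' = (\<lambda>h. h \<bullet> (\<Sum>b\<in>Basis. f' b *\<^sub>R b))" by blast
  with f' have "GDERIV f x :> (\<Sum>b\<in>Basis. f' b *\<^sub>R b)"
    unfolding gderiv_def by metis
  then show ?thesis unfolding grad_def by (rule someI)
qed

lemma gderiv_unique:
  assumes "GDERIV f x :> g" and "GDERIV f x :> g'"
  shows "g = g'"
proof -
  have "(\<lambda>h. h \<bullet> g) = (\<lambda>h. h \<bullet> g')"
    using assms unfolding gderiv_def by (rule has_derivative_unique)
  then have "(g - g') \<bullet> g = (g - g') \<bullet> g'" by metis
  then have "(g - g') \<bullet> (g - g') = 0" by (simp add: inner_diff_right)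
  then show ?thesis by simp
qed

lemma grad_eqI: "GDERIV f x :> g \<Longrightarrow> grad f x = g"
  unfolding grad_def by (metis gderiv_unique someI_ex)

lemma gderiv_along_line:
  assumes "GDERIV f (x + t *\<^sub>R d) :> g"
  shows "((\<lambda>t. f (x + t *\<^sub>R d)) has_real_derivative g \<bullet> d) (at t)"
proof -
  have "((\<lambda>t. x + t *\<^sub>R d) has_derivative (\<lambda>h. h *\<^sub>R d)) (at t)"
    by (auto intro!: derivative_eq_intros)
  from has_derivative_compose[OF this] assms
  have "((\<lambda>t. f (x + t *\<^sub>R d)) has_derivative (\<lambda>h. h *\<^sub>R d \<bullet> g)) (at t)"
    unfolding gderiv_def by blast
  then show ?thesis
    by (simp add: has_field_derivative_def inner_commute mult_commute_abs)
qed

text \<open>The source of the first-order inequalities of convex functions: dividing by \<open>t\<close> and letting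
  \<open>t\<close> tend to 0 turns a bound on chords into a bound on the directional derivative. The
  coefficient \<open>m\<close> absorbs the quadratic remainder that strong convexity produces.\<close>

lemma gderiv_le_chord_slope:
  assumes f: "GDERIV f x :> g"
    and chord: "\<And>t. 0 < t \<Longrightarrow> t < 1 \<Longrightarrow> f (x + t *\<^sub>R d) - f x \<le> t * (c + t * m)"
  shows "g \<bullet> d \<le> c"
proof (rule tendsto_le)
  have "((\<lambda>t. f (x + t *\<^sub>R d)) has_real_derivative g \<bullet> d) (at 0)"
    by (rule gderiv_along_line) (use f in simp)
  then show "((\<lambda>t. (f (x + t *\<^sub>R d) - f x) / t) \<longlongrightarrow> g \<bullet> d) (at_right 0)"
    by (auto simp: DERIV_def intro: filterlim_at_split[THEN iffD1, THEN conjunct2])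
  show "((\<lambda>t. c + t * m) \<longlongrightarrow> c) (at_right 0)"
    by (auto intro!: tendsto_eq_intros)
  have "\<forall>\<^sub>F t in at_right (0::real). t \<in> {0<..<1}"
    by (rule eventually_at_right_real) simp
  then show "\<forall>\<^sub>F t in at_right 0. (f (x + t *\<^sub>R d) - f x) / t \<le> c + t * m"
    by eventually_elim (use chord in \<open>simp add: divide_le_eq mult.commute\<close>)
qed simp

lemma bregman_lower_bound:
  fixes f :: "'a::euclidean_space \<Rightarrow> real"
  assumes "strongly_convex_on \<beta> S f" "x \<in> S" "y \<in> S" "f differentiable (at y)"
  shows "\<beta> / 2 * (norm (x - y))\<^sup>2 \<le> bregman f x y"
proof -
  define N where "N = (norm (x - y))\<^sup>2"
  have "grad f y \<bullet> (x - y) \<le> f x - f y - \<beta> / 2 * N"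
  proof (rule gderiv_le_chord_slope[OF gderiv_grad[OF assms(4)]])
    fix t :: real assume t: "0 < t" "t < 1"
    have "y + t *\<^sub>R (x - y) = t *\<^sub>R x + (1 - t) *\<^sub>R y" by (simp add: algebra_simps)
    with assms(1-3) t have "f (y + t *\<^sub>R (x - y)) \<le> t * f x + (1 - t) * f y - \<beta> / 2 * t * (1 - t) * N"
      unfolding strongly_convex_on_def N_def by simp
    then show "f (y + t *\<^sub>R (x - y)) - f y \<le> t * (f x - f y - \<beta> / 2 * N + t * (\<beta> / 2 * N))"
      by (simp add: field_simps)
  qed
  then show ?thesis by (simp add: bregman_def N_def)
qed

lemma bregman_nonneg_if_convex:
  fixes f :: "'a::euclidean_space \<Rightarrow> real"
  assumes "convex_on S f" "x \<in> S" "y \<in> S" "f differentiable (at y)"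
  shows "0 \<le> bregman f x y"
proof -
  have "strongly_convex_on 0 S f"
    using assms(1) by (auto simp: strongly_convex_on_def convex_on_def)
  from bregman_lower_bound[OF this assms(2-4)] show ?thesis by simp
qed

text \<open>The descent lemma. Along the segment from \<open>y\<close> to \<open>x\<close>, the function minus its
  linearisation minus \<open>M / 2\<close> times the squared distance to \<open>y\<close> has nonpositive derivative.\<close>

lemma bregman_upper_bound:
  fixes f :: "'a::euclidean_space \<Rightarrow> real"
  assumes "convex S" and xy: "x \<in> S" "y \<in> S"
    and diff: "\<And>z. z \<in> S \<Longrightarrow> f differentiable (at z)"
    and lip: "M-lipschitz_on S (grad f)"
  shows "bregman f x y \<le> M / 2 * (norm (x - y))\<^sup>2"
proof -
  define d where "d = x - y"
  define \<phi> where "\<phi> t = f (y + t *\<^sub>R d) - t * (grad f y \<bullet> d) - M / 2 * t\<^sup>2 * (norm d)\<^sup>2" for t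
  have "\<phi> 0 \<ge> \<phi> 1"
  proof (rule DERIV_nonpos_imp_nonincreasing[where f = \<phi>])
    fix t :: real assume t: "0 \<le> t" "t \<le> 1"
    let ?z = "y + t *\<^sub>R d"
    have "?z = (1 - t) *\<^sub>R y + t *\<^sub>R x" by (simp add: d_def algebra_simps)
    with assms(1) xy t have z: "?z \<in> S" by (simp add: convexD_alt)
    let ?D = "grad f ?z \<bullet> d - grad f y \<bullet> d - M * t * (norm d)\<^sup>2"
    have "(\<phi> has_real_derivative ?D) (at t)"
      unfolding \<phi>_def
      by (auto intro!: derivative_eq_intros gderiv_along_line[OF gderiv_grad[OF diff[OF z]]])
    moreover have "?D \<le> 0"
    proof -
      have "grad f ?z \<bullet> d - grad f y \<bullet> d \<le> norm (grad f ?z - grad f y) * norm d"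
        by (metis inner_diff_left norm_cauchy_schwarz)
      also have "\<dots> \<le> (M * norm (?z - y)) * norm d"
        by (intro mult_right_mono lipschitz_on_normD[OF lip z xy(2)]) simp
      also have "\<dots> = M * t * (norm d)\<^sup>2" using t by (simp add: power2_eq_square)
      finally show ?thesis by simp
    qed
    ultimately show "\<exists>D. (\<phi> has_real_derivative D) (at t) \<and> D \<le> 0" by blast
  qed simp
  then show ?thesis by (simp add: \<phi>_def bregman_def d_def)
qed

lemma bregman_three_points:
  "(grad K x - grad K a) \<bullet> (v - x) = bregman K v a - bregman K v x - bregman K x a"
  by (simp add: bregman_def inner_diff_left inner_diff_right)

section \<open>The primal step\<close>

text \<open>Convexity of \<open>h\<close> on segments through the minimiser \<open>x\<close> replaces the subdifferential
  inclusion for \<open>h\<close>: moving from \<open>x\<close> towards \<open>v\<close> cannot decrease the subproblem, and in the limit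
  this is the variational inequality for \<open>\<nabla>K(x) - \<nabla>K(a)\<close>, which the three-point identity
  rewrites.\<close>

lemma bregman_proximal_step:
  fixes K :: "'a::euclidean_space \<Rightarrow> real"
  assumes h: "convex_on V h" and K: "K differentiable (at x)" and e: "e > 0"
    and x: "x \<in> V"
    and min: "\<And>w. w \<in> V \<Longrightarrow> h x + bregman K x a / e \<le> h w + bregman K w a / e"
    and v: "v \<in> V"
  shows "e * (h x - h v) \<le> bregman K v a - bregman K v x - bregman K x a"
proof -
  have "GDERIV (\<lambda>w. - bregman K w a) x :> - (grad K x - grad K a)"
    unfolding bregman_def gderiv_def
    by (rule derivative_eq_intros gderiv_grad[OF K, unfolded gderiv_def] refl |
        simp add: inner_diff_right inner_commute)+
  then have "- (grad K x - grad K a) \<bullet> (v - x) \<le> e * (h v - h x)"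
  proof (rule gderiv_le_chord_slope[where m = 0])
    fix t :: real assume t: "0 < t" "t < 1"
    let ?w = "x + t *\<^sub>R (v - x)"
    have w: "?w = (1 - t) *\<^sub>R x + t *\<^sub>R v" by (simp add: algebra_simps)
    have "?w \<in> V" using h x v t unfolding w by (simp add: convex_on_def convexD_alt)
    from min[OF this] have "(bregman K x a - bregman K ?w a) / e \<le> h ?w - h x"
      by (simp add: diff_divide_distrib)
    with e have "bregman K x a - bregman K ?w a \<le> e * (h ?w - h x)"
      by (simp add: pos_divide_le_eq mult.commute)
    also have "\<dots> \<le> e * (t * (h v - h x))"
    proof (intro mult_left_mono)
      have "h ?w \<le> (1 - t) * h x + t * h v"
        unfolding w using convex_onD[OF h] x v t by simp
      then show "h ?w - h x \<le> t * (h v - h x)" by (simp add: algebra_simps)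
    qed (use e in simp)
    finally show "- bregman K ?w a - - bregman K x a \<le> t * (e * (h v - h x) + t * 0)"
      by (simp add: algebra_simps)
  qed
  then show ?thesis
    unfolding bregman_three_points[symmetric] by (simp add: algebra_simps)
qed

text \<open>The gradient inequality at \<open>v\<close> and the descent lemma at \<open>x\<close> replace the linearised \<open>f\<close> by
  \<open>f\<close> itself, at the price of \<open>M / 2\<close> times the squared step length. The term \<open>bregman K x a\<close> left
  over by the proximal step is at least \<open>\<beta> / 2\<close> times the same quantity.\<close>

lemma linearised_proximal_step:
  fixes K f :: "'a::euclidean_space \<Rightarrow> real"
  assumes K: "strongly_convex_on \<beta> U K" "\<And>z. z \<in> U \<Longrightarrow> K differentiable (at z)"
    and f: "convex_on U f" "\<And>z. z \<in> U \<Longrightarrow> f differentiable (at z)" "M-lipschitz_on U (grad f)"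
    and h: "convex_on V h" and VU: "V \<subseteq> U" and e: "e > 0"
    and a: "a \<in> U" and x: "x \<in> V" and v: "v \<in> V"
    and min: "\<And>w. w \<in> V \<Longrightarrow>
      grad f a \<bullet> x + h x + bregman K x a / e \<le> grad f a \<bullet> w + h w + bregman K w a / e"
  shows "e * ((f x + h x) - (f v + h v))
    \<le> bregman K v a - bregman K v x - (\<beta> - e * M) / 2 * (norm (x - a))\<^sup>2"
proof -
  have xU: "x \<in> U" and vU: "v \<in> U" using x v VU by auto
  have "convex V" using h by (simp add: convex_on_def)
  then have "convex_on V (\<lambda>w. grad f a \<bullet> w)"
    by (simp add: convex_on_def inner_add_right)
  then have "convex_on V (\<lambda>w. grad f a \<bullet> w + h w)" using h by (rule convex_on_add)
  from bregman_proximal_step[OF this K(2)[OF xU] e x min v]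
  have prox: "e * (grad f a \<bullet> x + h x - (grad f a \<bullet> v + h v))
    \<le> bregman K v a - bregman K v x - bregman K x a" .
  have "f x - f v \<le> grad f a \<bullet> x - grad f a \<bullet> v + M / 2 * (norm (x - a))\<^sup>2"
    using bregman_upper_bound[OF _ xU a f(2) f(3)] f(1)
      bregman_nonneg_if_convex[OF f(1) vU a f(2)[OF a]]
    by (simp add: convex_on_def bregman_def inner_diff_right)
  then have "e * ((f x + h x) - (f v + h v))
      \<le> e * ((grad f a \<bullet> x + h x - (grad f a \<bullet> v + h v)) + M / 2 * (norm (x - a))\<^sup>2)"
    using e by (intro mult_left_mono) auto
  also have "\<dots> \<le> bregman K v a - bregman K v x - bregman K x a + e * M / 2 * (norm (x - a))\<^sup>2"
    using prox by (simp add: algebra_simps)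
  also have "\<dots> \<le> bregman K v a - bregman K v x - (\<beta> - e * M) / 2 * (norm (x - a))\<^sup>2"
    using bregman_lower_bound[OF K(1) xU a K(2)[OF a]] by (simp add: algebra_simps diff_divide_distrib)
  finally show ?thesis .
qed

section \<open>The dual cone and the dual step\<close>

lemma convex_cone_dual_cone: "convex_cone (dual_cone C)"
proof -
  have "0 \<in> dual_cone C" by (simp add: dual_cone_def)
  moreover have "convex (dual_cone C)"
    by (auto simp: convex_def dual_cone_def inner_add_left)
  moreover have "conic (dual_cone C)"
    by (auto simp: conic_def dual_cone_def)
  ultimately show ?thesis by (auto simp: convex_cone_def)
qed

lemma closed_dual_cone: "closed (dual_cone C)"
proof -
  have "dual_cone C = (\<Inter>x\<in>C. {y. 0 \<le> y \<bullet> x})" by (auto simp: dual_cone_def)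
  moreover have "closed {y. 0 \<le> y \<bullet> x}" for x :: 'a
    by (intro closed_Collect_le continuous_intros)
  ultimately show ?thesis by auto
qed

lemma convex_on_inner_cone_convex:
  assumes "cone_convex_on C S F" "convex S" "y \<in> dual_cone C"
  shows "convex_on S (\<lambda>u. y \<bullet> F u)"
proof (rule convex_onI)
  fix t :: real and u v assume t: "0 < t" "t < 1" and uv: "u \<in> S" "v \<in> S"
  let ?w = "(1 - t) *\<^sub>R u + t *\<^sub>R v"
  have "F ?w - (1 - t) *\<^sub>R F u - t *\<^sub>R F v \<in> uminus ` C"
    using assms(1)[unfolded cone_convex_on_def, rule_format, OF uv, of "1 - t"] t by simp
  then obtain c where "c \<in> C" "F ?w - (1 - t) *\<^sub>R F u - t *\<^sub>R F v = - c" by auto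
  moreover from this have "0 \<le> y \<bullet> c" using assms(3) by (simp add: dual_cone_def)
  ultimately have "y \<bullet> (F ?w - (1 - t) *\<^sub>R F u - t *\<^sub>R F v) \<le> 0" by simp
  then show "y \<bullet> F ?w \<le> (1 - t) * (y \<bullet> F u) + t * (y \<bullet> F v)"
    by (simp add: inner_diff_right)
qed (rule assms(2))

text \<open>Moreau decomposition: the residual \<open>x - closest_point P x\<close> is orthogonal to the projection
  and lies in the polar cone of \<open>P\<close>.\<close>

lemma inner_projection_cone:
  fixes P :: "'a::euclidean_space set"
  assumes P: "closed P" "convex_cone P"
  shows "x \<bullet> closest_point P x = (norm (closest_point P x))\<^sup>2"
    and "y \<in> P \<Longrightarrow> y \<bullet> x \<le> y \<bullet> closest_point P x"
proof -
  let ?c = "closest_point P x"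
  have cone: "P \<noteq> {}" "convex P" "conic P" using P(2) by (auto simp: convex_cone_def)
  have c: "?c \<in> P" by (rule closest_point_in_set[OF P(1) cone(1)])
  have dot: "(x - ?c) \<bullet> (z - ?c) \<le> 0" if "z \<in> P" for z
    by (rule closest_point_dot[OF cone(2) P(1) that])
  have "2 *\<^sub>R ?c \<in> P" "0 *\<^sub>R ?c \<in> P" using conicD[OF cone(3) c] by (simp_all del: scaleR_zero_left)
  from dot[OF this(1)] dot[OF this(2)] have orth: "(x - ?c) \<bullet> ?c = 0"
    by (simp add: scaleR_2)
  then show "x \<bullet> ?c = (norm ?c)\<^sup>2" by (simp add: inner_diff_left power2_norm_eq_inner)
  show "y \<bullet> x \<le> y \<bullet> ?c" if "y \<in> P"
    using dot[OF that] orth by (simp add: inner_diff_left inner_diff_right inner_commute)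
qed

text \<open>Both \<open>q\<close> and \<open>p'\<close> are projections from the same base point \<open>p\<close>. Testing the projection
  inequality of \<open>p'\<close> against \<open>y\<close>, and that of \<open>q\<close> against \<open>p'\<close>, leaves the cross term
  \<open>2 * \<gamma> * ((s' - s) \<bullet> (p' - q))\<close>, which completing the square with the squared norm of
  \<open>p' - q\<close> turns into the last summand.\<close>

lemma extragradient_step:
  fixes P :: "'a::euclidean_space set"
  assumes P: "closed P" "convex P" and y: "y \<in> P"
    and q: "q = closest_point P (p + \<gamma> *\<^sub>R s)"
    and p': "p' = closest_point P (p + \<gamma> *\<^sub>R s')"
  shows "2 * \<gamma> * ((y - q) \<bullet> s') \<le> (norm (y - p))\<^sup>2 - (norm (y - p'))\<^sup>2 + \<gamma>\<^sup>2 * (norm (s' - s))\<^sup>2"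
proof -
  have P': "p' \<in> P" unfolding p' using P y by (intro closest_point_in_set) auto
  have 1: "(p + \<gamma> *\<^sub>R s' - p') \<bullet> (y - p') \<le> 0"
    unfolding p' by (rule closest_point_dot[OF P(2,1) y])
  have 2: "(p + \<gamma> *\<^sub>R s - q) \<bullet> (p' - q) \<le> 0"
    unfolding q by (rule closest_point_dot[OF P(2,1) P'])
  have 3: "0 \<le> (norm ((p' - q) - \<gamma> *\<^sub>R (s' - s)))\<^sup>2 + (norm (q - p))\<^sup>2" by simp
  have "(norm (y - p))\<^sup>2 - (norm (y - p'))\<^sup>2 + \<gamma>\<^sup>2 * (norm (s' - s))\<^sup>2 - 2 * \<gamma> * ((y - q) \<bullet> s')
    = (norm ((p' - q) - \<gamma> *\<^sub>R (s' - s)))\<^sup>2 + (norm (q - p))\<^sup>2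
      - 2 * ((p + \<gamma> *\<^sub>R s' - p') \<bullet> (y - p')) - 2 * ((p + \<gamma> *\<^sub>R s - q) \<bullet> (p' - q))"
    unfolding power2_norm_eq_inner
    by (simp add: inner_diff_left inner_diff_right inner_add_left inner_add_right inner_commute
        power2_eq_square algebra_simps)
  with 1 2 3 show ?thesis by linarith
qed

section \<open>Averaging\<close>

lemma weighted_mean_in_convex:
  assumes "convex S" and w: "\<And>k. 0 < w k" and "\<And>k. x k \<in> S"
  shows "weighted_mean w x t \<in> S"
proof -
  have "0 < (\<Sum>k=0..t. w k)" by (intro sum_pos) (auto simp: w)
  then show ?thesis
    unfolding weighted_mean_def scaleR_sum_right scaleR_scaleR
    using assms by (intro convex_sum) (auto simp: sum_distrib_left[symmetric] less_imp_le)
qed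

lemma weighted_mean_jensen:
  assumes f: "convex_on S f" and w: "\<And>k. 0 < w k" and x: "\<And>k. x k \<in> S"
  shows "(\<Sum>k=0..t. w k) * f (weighted_mean w x t) \<le> (\<Sum>k=0..t. w k * f (x k))"
proof -
  define W where "W = (\<Sum>k=0..t. w k)"
  have W: "0 < W" unfolding W_def by (intro sum_pos) (auto simp: w)
  have "f (\<Sum>k=0..t. (w k / W) *\<^sub>R x k) \<le> (\<Sum>k=0..t. w k / W * f (x k))"
    using W x w by (intro convex_on_sum[OF _ _ f])
      (auto simp: sum_divide_distrib[symmetric] W_def[symmetric] less_imp_le)
  also have "(\<Sum>k=0..t. (w k / W) *\<^sub>R x k) = weighted_mean w x t"
    by (simp add: weighted_mean_def W_def scaleR_sum_right divide_inverse_commute)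
  finally show ?thesis
    using W unfolding W_def[symmetric]
    by (simp add: sum_divide_distrib[symmetric] field_simps)
qed

text \<open>Summation by parts; decreasing weights give the boundary terms the right sign.\<close>

lemma weighted_telescoping_le:
  fixes w b :: "nat \<Rightarrow> real"
  assumes "\<And>k. w (Suc k) \<le> w k" "\<And>k. 0 \<le> b k"
  shows "(\<Sum>k=0..t. w k * (b k - b (Suc k))) \<le> w 0 * b 0 - w t * b (Suc t)"
proof (induction t)
  case 0
  then show ?case by (simp add: algebra_simps)
next
  case (Suc t)
  have "w (Suc t) * b (Suc t) \<le> w t * b (Suc t)" using assms by (intro mult_right_mono)
  with Suc show ?case by (simp add: algebra_simps)
qed

text \<open>For fixed \<open>y\<close> the first part of the gap is convex in the primal variable (Jensen), and for
  fixed \<open>v\<close> the second is affine in the multiplier (equality). The total weight is at least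
  \<open>lo * (real t + 1)\<close>, and dividing by this smaller number is legitimate because the numerator is
  nonnegative.\<close>

lemma ergodic_saddle_gap:
  fixes w a b :: "nat \<Rightarrow> real" and x :: "nat \<Rightarrow> 'a::real_vector" and q :: "nat \<Rightarrow> 'b::real_inner"
  assumes f: "convex_on V (\<lambda>z. f z + y \<bullet> \<Theta> z)" and x: "\<And>k. x k \<in> V"
    and w: "0 < lo" "\<And>k. lo \<le> w k" "\<And>k. w (Suc k) \<le> w k"
    and nonneg: "\<And>k. 0 \<le> a k" "\<And>k. 0 \<le> b k"
    and step: "\<And>k. w k * ((f (x k) + y \<bullet> \<Theta> (x k)) - (f v + q k \<bullet> \<Theta> v))
      \<le> a k - a (Suc k) + w k * (b k - b (Suc k))"
  shows "(f (weighted_mean w x t) + y \<bullet> \<Theta> (weighted_mean w x t))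
      - (f v + weighted_mean w q t \<bullet> \<Theta> v) \<le> (a 0 + w 0 * b 0) / (lo * (real t + 1))"
    (is "?gap \<le> _")
proof -
  have pos: "0 < w k" for k using w(1) w(2)[of k] by linarith
  define W where "W = (\<Sum>k=0..t. w k)"
  have Wpos: "0 < W" unfolding W_def by (intro sum_pos) (auto simp: pos)
  have "(\<Sum>k=0..t. lo) \<le> W" unfolding W_def by (intro sum_mono w(2))
  then have Wge: "lo * (real t + 1) \<le> W" by (simp add: algebra_simps)
  have "W * (f v + weighted_mean w q t \<bullet> \<Theta> v) = (\<Sum>k=0..t. w k * (f v + q k \<bullet> \<Theta> v))"
    using Wpos by (simp add: weighted_mean_def W_def[symmetric] inner_sum_left distrib_left
        sum.distrib sum_distrib_right[symmetric])
  then have "W * ?gap \<le> (\<Sum>k=0..t. w k * ((f (x k) + y \<bullet> \<Theta> (x k)) - (f v + q k \<bullet> \<Theta> v)))"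
    using weighted_mean_jensen[of V "\<lambda>z. f z + y \<bullet> \<Theta> z" w x t, OF f pos x]
    unfolding W_def[symmetric] by (simp add: right_diff_distrib sum_subtractf)
  also have "\<dots> \<le> (\<Sum>k=0..t. (a k - a (Suc k)) + w k * (b k - b (Suc k)))"
    by (intro sum_mono step)
  also have "\<dots> \<le> (a 0 - a (Suc t)) + (w 0 * b 0 - w t * b (Suc t))"
    using weighted_telescoping_le[of w b t, OF w(3) nonneg(2)]
      sum_telescope[of a t] by (simp add: sum.distrib atMost_atLeast0)
  also have "\<dots> \<le> a 0 + w 0 * b 0"
    using nonneg(1)[of "Suc t"] mult_nonneg_nonneg[OF less_imp_le[OF pos[of t]] nonneg(2)[of "Suc t"]]
    by linarith
  finally have "?gap \<le> (a 0 + w 0 * b 0) / W" using Wpos by (simp add: field_simps)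
  also have "\<dots> \<le> (a 0 + w 0 * b 0) / (lo * (real t + 1))"
    using nonneg(1)[of 0] nonneg(2)[of 0] pos[of 0] Wge w(1)
    by (intro divide_left_mono) (auto intro!: add_nonneg_nonneg mult_nonneg_nonneg mult_pos_pos Wpos less_imp_le)
  finally show ?thesis .
qed


section \<open>One iteration\<close>

text \<open>The subproblem uses the Frechet derivative of \<open>\<Omega>\<close>, whereas the Lipschitz hypothesis
  concerns the gradient of \<open>y \<bullet> \<Omega>\<close>. These identities let the two be merged with \<open>G\<close> into a single
  smooth function.\<close>

lemma grad_add_inner:
  fixes G :: "'a::euclidean_space \<Rightarrow> real" and \<Omega> :: "'a \<Rightarrow> 'b::euclidean_space"
  assumes "G differentiable (at a)" "\<Omega> differentiable (at a)"
  shows "grad (\<lambda>v. G v + y \<bullet> \<Omega> v) a = grad G a + grad (\<lambda>v. y \<bullet> \<Omega> v) a"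
    and "grad (\<lambda>v. G v + y \<bullet> \<Omega> v) a \<bullet> w = grad G a \<bullet> w + y \<bullet> frechet_derivative \<Omega> (at a) w"
proof -
  have \<Omega>: "((\<lambda>v. y \<bullet> \<Omega> v) has_derivative (\<lambda>h. y \<bullet> frechet_derivative \<Omega> (at a) h)) (at a)"
    using assms(2) by (intro has_derivative_inner_right) (simp add: frechet_derivative_works)
  then have "(\<lambda>v. y \<bullet> \<Omega> v) differentiable (at a)" by (auto simp: differentiable_def)
  note g = gderiv_grad[OF this]
  show eq: "grad (\<lambda>v. G v + y \<bullet> \<Omega> v) a = grad G a + grad (\<lambda>v. y \<bullet> \<Omega> v) a"
    by (intro grad_eqI GDERIV_add gderiv_grad[OF assms(1)] g)
  have "(\<lambda>h. h \<bullet> grad (\<lambda>v. y \<bullet> \<Omega> v) a) = (\<lambda>h. y \<bullet> frechet_derivative \<Omega> (at a) h)"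
    using g \<Omega> unfolding gderiv_def by (rule has_derivative_unique)
  then have "grad (\<lambda>v. y \<bullet> \<Omega> v) a \<bullet> w = y \<bullet> frechet_derivative \<Omega> (at a) w"
    by (metis inner_commute)
  then show "grad (\<lambda>v. G v + y \<bullet> \<Omega> v) a \<bullet> w = grad G a \<bullet> w + y \<bullet> frechet_derivative \<Omega> (at a) w"
    by (simp add: eq inner_add_left)
qed

text \<open>With the multiplier held fixed at \<open>q\<close>, the smooth part is \<open>f = G + q \<bullet> \<Omega>\<close> and the proximal part
  \<open>h = j + q \<bullet> \<Phi>\<close>, both convex because \<open>q\<close> lies in the dual cone. Adding the dual estimate
  replaces \<open>q\<close> by an arbitrary \<open>y\<close> in the Lagrangian at \<open>x\<close>, and the step size condition makes
  the total coefficient of \<open>(norm (x - a))\<^sup>2\<close> nonpositive.\<close>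

lemma vapp_iteration:
  fixes G K j :: "'a::euclidean_space \<Rightarrow> real" and \<Omega> \<Phi> :: "'a \<Rightarrow> 'b::euclidean_space"
  defines "\<Theta> \<equiv> \<lambda>v. \<Omega> v + \<Phi> v"
  assumes j: "convex_on V j" and VU: "V \<subseteq> U"
    and K: "strongly_convex_on \<beta> U K" "\<And>z. z \<in> U \<Longrightarrow> K differentiable (at z)"
    and G: "convex_on U G" "\<And>z. z \<in> U \<Longrightarrow> G differentiable (at z)" "M-lipschitz_on U (grad G)"
    and \<Omega>: "cone_convex_on C U \<Omega>" "\<And>z. z \<in> U \<Longrightarrow> \<Omega> differentiable (at z)"
      "\<And>y. N-lipschitz_on U (grad (\<lambda>v. y \<bullet> \<Omega> v))"
    and \<Phi>: "cone_convex_on C U \<Phi>"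
    and \<Theta>: "\<tau>-lipschitz_on U \<Theta>"
    and e: "e > 0" "e * (M + N + \<gamma> * \<tau>\<^sup>2) \<le> \<beta>" and \<gamma>: "\<gamma> > 0"
    and a: "a \<in> U" and x: "x \<in> V" and v: "v \<in> V" and y: "y \<in> dual_cone C"
    and q: "q = vapp_dual_step C \<Theta> \<gamma> p a" and p': "p' = vapp_dual_step C \<Theta> \<gamma> p x"
    and min: "\<And>w. w \<in> V \<Longrightarrow>
      grad G a \<bullet> x + j x + q \<bullet> (frechet_derivative \<Omega> (at a) x + \<Phi> x) + bregman K x a / e
      \<le> grad G a \<bullet> w + j w + q \<bullet> (frechet_derivative \<Omega> (at a) w + \<Phi> w) + bregman K w a / e"
  shows "e * ((G x + j x + y \<bullet> \<Theta> x) - (G v + j v + q \<bullet> \<Theta> v))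
    \<le> bregman K v a - bregman K v x
      + e * ((norm (y - p))\<^sup>2 / (2 * \<gamma>) - (norm (y - p'))\<^sup>2 / (2 * \<gamma>))"
proof -
  let ?P = "dual_cone C"
  have P: "closed ?P" "convex ?P" "?P \<noteq> {}"
    using closed_dual_cone convex_cone_dual_cone by (auto simp: convex_cone_def)
  have qP: "q \<in> ?P"
    unfolding q vapp_dual_step_def by (rule closest_point_in_set[OF P(1,3)])
  have U: "convex U" and V: "convex V" using G(1) j by (auto simp: convex_on_def)
  define f where "f = (\<lambda>v. G v + q \<bullet> \<Omega> v)"
  define h where "h = (\<lambda>v. j v + q \<bullet> \<Phi> v)"
  have "(\<lambda>v. q \<bullet> \<Omega> v) differentiable (at z)" if "z \<in> U" for z
    using \<Omega>(2)[OF that] unfolding differentiable_def by (blast intro: has_derivative_inner_right)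
  then have diff: "f differentiable (at z)" if "z \<in> U" for z
    unfolding f_def using that G(2) by (intro differentiable_add) auto
  have "(M + N)-lipschitz_on U (\<lambda>v. grad G v + grad (\<lambda>v. q \<bullet> \<Omega> v) v)"
    by (intro lipschitz_on_add G \<Omega>)
  then have lip: "(M + N)-lipschitz_on U (grad f)"
    unfolding f_def by (rule lipschitz_on_transform) (use grad_add_inner(1) G(2) \<Omega>(2) in metis)
  have f: "convex_on U f"
    unfolding f_def by (intro convex_on_add G convex_on_inner_cone_convex[OF \<Omega>(1) U qP])
  have h: "convex_on V h"
    unfolding h_def using convex_on_inner_cone_convex[OF \<Phi> U qP] VU V
    by (intro convex_on_add j) (rule convex_on_subset)
  define D where "D = (norm (x - a))\<^sup>2"
  have "e * ((f x + h x) - (f v + h v))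
      \<le> bregman K v a - bregman K v x - (\<beta> - e * (M + N)) / 2 * D"
    unfolding D_def
  proof (rule linearised_proximal_step[OF K f diff lip h VU e(1) a x v])
    fix w assume "w \<in> V"
    from min[OF this] show "grad f a \<bullet> x + h x + bregman K x a / e
      \<le> grad f a \<bullet> w + h w + bregman K w a / e"
      unfolding f_def h_def grad_add_inner(2)[OF G(2)[OF a] \<Omega>(2)[OF a]]
      by (simp add: inner_add_right)
  qed
  then have primal: "e * ((G x + j x + q \<bullet> \<Theta> x) - (G v + j v + q \<bullet> \<Theta> v))
      \<le> bregman K v a - bregman K v x - (\<beta> - e * (M + N)) / 2 * D"
    by (simp add: f_def h_def \<Theta>_def inner_add_right algebra_simps)
  have "2 * \<gamma> * ((y - q) \<bullet> \<Theta> x)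
      \<le> (norm (y - p))\<^sup>2 - (norm (y - p'))\<^sup>2 + \<gamma>\<^sup>2 * (norm (\<Theta> x - \<Theta> a))\<^sup>2"
    using q p' unfolding vapp_dual_step_def by (rule extragradient_step[OF P(1,2) y])
  also have "(norm (\<Theta> x - \<Theta> a))\<^sup>2 \<le> (\<tau> * norm (x - a))\<^sup>2"
    using lipschitz_on_normD[OF \<Theta>] x VU a by (intro power_mono) auto
  finally have "2 * \<gamma> * ((y - q) \<bullet> \<Theta> x)
      \<le> (norm (y - p))\<^sup>2 - (norm (y - p'))\<^sup>2 + \<gamma>\<^sup>2 * (\<tau>\<^sup>2 * D)"
    by (simp add: D_def power_mult_distrib mult_left_mono)
  then have "(y - q) \<bullet> \<Theta> x
      \<le> (norm (y - p))\<^sup>2 / (2 * \<gamma>) - (norm (y - p'))\<^sup>2 / (2 * \<gamma>) + \<gamma> * \<tau>\<^sup>2 / 2 * D"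
    using \<gamma> by (simp add: field_simps power2_eq_square)
  then have dual: "e * ((y - q) \<bullet> \<Theta> x)
      \<le> e * ((norm (y - p))\<^sup>2 / (2 * \<gamma>) - (norm (y - p'))\<^sup>2 / (2 * \<gamma>) + \<gamma> * \<tau>\<^sup>2 / 2 * D)"
    using e(1) by (intro mult_left_mono) auto
  have "0 \<le> (\<beta> - e * (M + N + \<gamma> * \<tau>\<^sup>2)) / 2 * D"
    using e(2) by (simp add: D_def)
  with primal dual show ?thesis by (simp add: field_simps inner_diff_left)
qed

section \<open>Saddle points\<close>

text \<open>Weak duality together with the saddle inequality: the dual function never exceeds \<open>L us\<close>, and
  at \<open>ps\<close> it attains the saddle value.\<close>

lemma saddle_point_imp_dual_maximizer:
  assumes "saddle_point L U P us ps"
  shows "is_arg_max (dual_function L U) (\<lambda>y. y \<in> P) ps"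
proof -
  from assms have us: "us \<in> U" "ps \<in> P"
    and le: "\<And>v y. v \<in> U \<Longrightarrow> y \<in> P \<Longrightarrow> L us y \<le> L us ps \<and> L us ps \<le> L v ps"
    by (auto simp: saddle_point_def)
  have "dual_function L U y \<le> dual_function L U ps" if "y \<in> P" for y
  proof -
    have "dual_function L U y \<le> L us y" unfolding dual_function_def by (rule INF_lower[OF us(1)])
    also have "\<dots> \<le> L us ps" using le us that by blast
    also have "\<dots> \<le> dual_function L U ps"
      unfolding dual_function_def using le us by (intro INF_greatest) blast
    finally show ?thesis .
  qed
  with us show ?thesis by (auto simp: is_arg_max_def not_less)
qed

text \<open>Complementary slackness: comparing \<open>ps\<close> with the multipliers \<open>0\<close> and \<open>2 *\<^sub>R ps\<close> forces
  \<open>ps \<bullet> \<Theta> us = 0\<close>, so the saddle value is the objective value \<open>c\<close> at \<open>us\<close>.\<close>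

lemma saddle_point_cone_value:
  assumes saddle: "saddle_point (lagrangian G J \<Theta>) U P us ps" and P: "convex_cone P"
    and fin: "objective G J us = ereal c"
  shows "y \<in> P \<Longrightarrow> lagrangian G J \<Theta> us y \<le> ereal c"
    and "v \<in> U \<Longrightarrow> ereal c \<le> lagrangian G J \<Theta> v ps"
proof -
  from saddle have us: "us \<in> U" "ps \<in> P"
    and le: "\<And>y. y \<in> P \<Longrightarrow> y \<bullet> \<Theta> us \<le> ps \<bullet> \<Theta> us"
    and ge: "\<And>v. v \<in> U \<Longrightarrow> lagrangian G J \<Theta> us ps \<le> lagrangian G J \<Theta> v ps"
    unfolding saddle_point_def lagrangian_def fin by auto
  have "conic P" using P by (simp add: convex_cone_def)
  then have "0 *\<^sub>R ps \<in> P" "2 *\<^sub>R ps \<in> P" using us by (simp_all add: conicD del: scaleR_zero_left)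
  from le[OF this(1)] le[OF this(2)] have "ps \<bullet> \<Theta> us = 0" by simp
  with le ge show "y \<in> P \<Longrightarrow> lagrangian G J \<Theta> us y \<le> ereal c"
    "v \<in> U \<Longrightarrow> ereal c \<le> lagrangian G J \<Theta> v ps"
    unfolding lagrangian_def fin by fastforce+
qed

text \<open>Here \<open>fz\<close> and \<open>s\<close> stand for the objective and the constraint value at the average, and \<open>c\<close>
  for the optimal value. The multiplier \<open>ps + \<pi> / norm \<pi>\<close>, with \<open>\<pi>\<close> the projection of \<open>s\<close>,
  exceeds \<open>M\<close> in norm by at most 1 and adds exactly \<open>norm \<pi>\<close> to \<open>ps \<bullet> s\<close>.\<close>

lemma gap_imp_residual_and_value_bounds:
  fixes P :: "'b::euclidean_space set"
  assumes P: "closed P" "convex_cone P" and ps: "ps \<in> P" "norm ps \<le> M"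
    and saddle: "c \<le> fz + ps \<bullet> s"
    and gap: "\<And>y. y \<in> P \<Longrightarrow> norm y \<le> M + 1 \<Longrightarrow> fz + y \<bullet> s - c \<le> r"
  shows "norm (closest_point P s) \<le> r" and "- (M * r) \<le> fz - c" and "fz - c \<le> r"
proof -
  let ?\<pi> = "closest_point P s"
  have cone: "P \<noteq> {}" "convex P" "conic P" using P(2) by (auto simp: convex_cone_def)
  have \<pi>: "?\<pi> \<in> P" by (rule closest_point_in_set[OF P(1) cone(1)])
  show res: "norm ?\<pi> \<le> r"
  \<comment> \<open>If the projection vanishes there is no direction to test; \<open>ps\<close> itself shows that \<open>r\<close> is nonnegative.\<close>
  proof (cases "?\<pi> = 0")
    case True
    with gap[OF ps(1)] ps(2) saddle show ?thesis by simp
  next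
    case False
    let ?y = "ps + ?\<pi> /\<^sub>R norm ?\<pi>"
    have "?\<pi> /\<^sub>R norm ?\<pi> \<in> P" by (rule conicD[OF cone(3) \<pi>]) simp
    then have "?y \<in> P" using P(2) ps(1) by (intro convex_cone_add)
    moreover have "norm ?y \<le> M + 1"
      using norm_triangle_ineq[of ps "?\<pi> /\<^sub>R norm ?\<pi>"] ps(2) False by simp
    ultimately have "fz + ?y \<bullet> s - c \<le> r" by (rule gap)
    moreover have "(?\<pi> /\<^sub>R norm ?\<pi>) \<bullet> s = norm ?\<pi>"
      using inner_projection_cone(1)[OF P, of s] False
      by (simp add: inner_commute power2_eq_square)
    ultimately show ?thesis using saddle by (simp add: inner_add_left)
  qed
  have "ps \<bullet> s \<le> ps \<bullet> ?\<pi>" by (rule inner_projection_cone(2)[OF P ps(1)])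
  also have "\<dots> \<le> norm ps * norm ?\<pi>" by (rule norm_cauchy_schwarz)
  also have "\<dots> \<le> M * r"
    using ps(2) res order_trans[OF norm_ge_zero ps(2)] by (intro mult_mono) auto
  finally show "- (M * r) \<le> fz - c" using saddle by simp
  have "0 \<in> P" using conicD[OF cone(3) ps(1), of 0] by simp
  from gap[OF this] order_trans[OF norm_ge_zero ps(2)] show "fz - c \<le> r" by simp
qed

section \<open>Restriction to the effective domain\<close>

lemma convex_on_real_of_ereal:
  assumes "ereal_convex J" "\<And>v. J v \<noteq> - \<infinity>" "convex U"
  shows "convex_on {v \<in> U. J v < \<infinity>} (\<lambda>v. real_of_ereal (J v))"
proof -
  have *: "J (\<mu> *\<^sub>R x + \<nu> *\<^sub>R y) \<le> ereal (\<mu> * real_of_ereal (J x) + \<nu> * real_of_ereal (J y))"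
    if "J x < \<infinity>" "J y < \<infinity>" "0 \<le> \<mu>" "0 \<le> \<nu>" "\<mu> + \<nu> = 1" for x y and \<mu> \<nu> :: real
  proof -
    have "J (\<mu> *\<^sub>R x + (1 - \<mu>) *\<^sub>R y) \<le> ereal \<mu> * J x + ereal (1 - \<mu>) * J y"
      using assms(1) that unfolding ereal_convex_def by auto
    moreover have "J x = ereal (real_of_ereal (J x))" "J y = ereal (real_of_ereal (J y))"
      using that assms(2)[of x] assms(2)[of y] by (cases "J x"; cases "J y"; simp)+
    moreover have "1 - \<mu> = \<nu>" using that by simp
    ultimately show ?thesis by (metis plus_ereal.simps(1) times_ereal.simps(1))
  qed
  show ?thesis
    unfolding convex_on_def convex_def
  proof (intro conjI ballI allI impI)
    fix x y and \<mu> \<nu> :: real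
    assume xy: "x \<in> {v \<in> U. J v < \<infinity>}" "y \<in> {v \<in> U. J v < \<infinity>}"
      and \<mu>: "0 \<le> \<mu>" "0 \<le> \<nu>" "\<mu> + \<nu> = 1"
    let ?z = "\<mu> *\<^sub>R x + \<nu> *\<^sub>R y"
    have le: "J ?z \<le> ereal (\<mu> * real_of_ereal (J x) + \<nu> * real_of_ereal (J y))"
      using xy \<mu> by (intro *) auto
    then have fin: "J ?z < \<infinity>" using le_less_trans by fastforce
    then show "?z \<in> {v \<in> U. J v < \<infinity>}" using xy \<mu> assms(3) by (auto simp: convex_def)
    have "J ?z = ereal (real_of_ereal (J ?z))" using fin assms(2)[of ?z] by (cases "J ?z") auto
    with le show "real_of_ereal (J ?z) \<le> \<mu> * real_of_ereal (J x) + \<nu> * real_of_ereal (J y)"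
      by (metis ereal_less_eq(3))
  qed
qed

section \<open>Convergence rate of the averages\<close>

theorem theorem2:
  fixes U :: "(real ^ 'n) set" and C :: "(real ^ 'm) set"
    and G K :: "real ^ 'n \<Rightarrow> real" and J :: "real ^ 'n \<Rightarrow> ereal"
    and \<Omega> \<Phi> \<Theta> :: "real ^ 'n \<Rightarrow> real ^ 'm"
    and L :: "real ^ 'n \<Rightarrow> real ^ 'm \<Rightarrow> ereal"
    and B\<^sub>G B\<^sub>\<Omega> B \<tau> \<beta> \<gamma> \<epsilon>lo \<epsilon>hi M\<^sub>0 d\<^sub>1 :: real
    and \<epsilon> :: "nat \<Rightarrow> real"
    and u :: "nat \<Rightarrow> real ^ 'n" and p q :: "nat \<Rightarrow> real ^ 'm"
    and us :: "real ^ 'n" and ps :: "real ^ 'm"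
    and ubar :: "nat \<Rightarrow> real ^ 'n" and pbar :: "nat \<Rightarrow> real ^ 'm"
  assumes U: "U \<noteq> {}" "closed U" "convex U"
    and C: "closed C" "convex_cone C"
    and \<Theta>_def: "\<Theta> = (\<lambda>v. \<Omega> v + \<Phi> v)"
    and L_def: "L = lagrangian G J \<Theta>"
    and H1: "\<forall>v. J v \<noteq> - \<infinity>" "ereal_convex J" "lower_semicontinuous J"
            "{v. J v < \<infinity>} \<inter> U \<noteq> {}"
    and H2: "convex_on U G" "\<forall>v\<in>U. G differentiable (at v)" "B\<^sub>G-lipschitz_on U (grad G)"
    and H3: "cone_convex_on C U \<Omega>" "cone_convex_on C U \<Phi>"
    and H4: "\<forall>v\<in>U. \<Omega> differentiable (at v)"
            "\<forall>y. B\<^sub>\<Omega>-lipschitz_on U (grad (\<lambda>v. y \<bullet> \<Omega> v))"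
    and H5: "\<exists>S. open S \<and> U \<subseteq> S \<and> \<tau>-lipschitz_on S \<Theta>"
    and H6: "interior C \<noteq> {} \<longrightarrow> \<Theta> ` U \<inter> uminus ` interior C \<noteq> {}"
            "C = {0} \<longrightarrow> 0 \<in> interior (\<Theta> ` U)"
    and H7: "\<exists>v y. saddle_point L U (dual_cone C) v y"
    and K: "\<beta> > 0" "strongly_convex_on \<beta> U K" "\<forall>v\<in>U. K differentiable (at v)"
           "B-lipschitz_on U (grad K)"
    and \<gamma>: "\<gamma> > 0"
    and vapp: "vapp_sequence U C G J \<Omega> \<Phi> K \<gamma> \<epsilon> u p q"
    and \<epsilon>: "0 < \<epsilon>lo" "\<forall>k. \<epsilon>lo \<le> \<epsilon> (Suc k) \<and> \<epsilon> (Suc k) \<le> \<epsilon> k \<and> \<epsilon> k \<le> \<epsilon>hi"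
           (* quotient in the extended reals, so that the bound is \<infinity> when the denominator is 0 *)
           "ereal \<epsilon>hi < ereal \<beta> / ereal (B\<^sub>G + B\<^sub>\<Omega> + \<gamma> * \<tau>\<^sup>2)"
    and saddle: "saddle_point L U (dual_cone C) us ps"
    and M\<^sub>0: "\<forall>y. is_arg_max (dual_function L U) (\<lambda>y'. y' \<in> dual_cone C) y \<longrightarrow> norm y \<le> M\<^sub>0"
    and d\<^sub>1_def: "d\<^sub>1 = (SUP y\<in>cball 0 (M\<^sub>0 + 1).
                    bregman K us (u 0) + \<epsilon> 0 / (2 * \<gamma>) * (norm (y - p 0))\<^sup>2)"
    and ubar_def: "ubar = weighted_mean \<epsilon> (\<lambda>k. u (Suc k))"
    and pbar_def: "pbar = weighted_mean \<epsilon> q"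
  shows "\<forall>t>0.
      ubar t \<in> U \<and> pbar t \<in> dual_cone C \<and>
      (\<forall>v\<in>U. \<forall>y\<in>dual_cone C.
         L (ubar t) y - L v (pbar t)
           \<le> ereal ((bregman K v (u 0) + \<epsilon> 0 / (2 * \<gamma>) * (norm (y - p 0))\<^sup>2)
                      / (\<epsilon>lo * (real t + 1)))) \<and>
      norm (closest_point (dual_cone C) (\<Theta> (ubar t))) \<le> d\<^sub>1 / (\<epsilon>lo * (real t + 1)) \<and>
      ereal (- (M\<^sub>0 * d\<^sub>1 / (\<epsilon>lo * (real t + 1)))) \<le> objective G J (ubar t) - objective G J us \<and>
      objective G J (ubar t) - objective G J us \<le> ereal (d\<^sub>1 / (\<epsilon>lo * (real t + 1)))"
proof -
  define P where "P = dual_cone C"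
  define V where "V = {v \<in> U. J v < \<infinity>}"
  define j where "j v = real_of_ereal (J v)" for v
  define f where "f v = G v + j v" for v
  have P: "closed P" "convex_cone P" "convex P"
    using closed_dual_cone[of C] convex_cone_dual_cone[of C] by (auto simp: P_def convex_cone_def)
  have J: "J v = ereal (j v)" if "v \<in> V" for v
    using that H1(1)[rule_format, of v] by (cases "J v") (auto simp: V_def j_def)
  have j: "convex_on V j" unfolding V_def j_def using convex_on_real_of_ereal H1(1,2) U(3) by blast
  have VU: "V \<subseteq> U" by (auto simp: V_def)
  have L: "L v y = ereal (f v + y \<bullet> \<Theta> v)" if "v \<in> V" for v y
    by (simp add: L_def lagrangian_def objective_def f_def J[OF that])
  have obj: "objective G J v = ereal (f v)" if "v \<in> V" for v
    by (simp add: objective_def f_def J[OF that])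
  obtain v0 where v0: "v0 \<in> V" using H1(4) by (auto simp: V_def)
  have ps: "us \<in> U" "ps \<in> P" using saddle by (auto simp: saddle_point_def P_def)
  \<comment> \<open>Otherwise the saddle value would be infinite, yet it is at most \<open>L v0 ps\<close>.\<close>
  have us: "us \<in> V"
  proof -
    have "L us ps \<le> L v0 ps"
      using saddle v0 VU by (auto simp: saddle_point_def)
    then have "L us ps \<noteq> \<infinity>" by (auto simp: L[OF v0])
    then show ?thesis using ps by (auto simp: V_def L_def lagrangian_def objective_def)
  qed
  have ps_norm: "norm ps \<le> M\<^sub>0"
    using M\<^sub>0 saddle_point_imp_dual_maximizer[OF saddle] by blast
  have \<Theta>_lip: "\<tau>-lipschitz_on U \<Theta>" using H5 lipschitz_on_subset by blast
  have cstpos: "0 \<le> B\<^sub>G + B\<^sub>\<Omega> + \<gamma> * \<tau>\<^sup>2"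
    using lipschitz_on_nonneg[OF H2(3)] lipschitz_on_nonneg[OF H4(2)[rule_format]] \<gamma> by simp
  have \<epsilon>lo: "\<epsilon>lo \<le> \<epsilon> k" for k
    using \<epsilon>(2) by (cases k) (auto intro: order_trans)
  then have \<epsilon>pos: "0 < \<epsilon> k" for k using \<epsilon>(1) less_le_trans by blast
  have step: "\<epsilon> k * (B\<^sub>G + B\<^sub>\<Omega> + \<gamma> * \<tau>\<^sup>2) \<le> \<beta>" for k
  proof -
    have "\<epsilon>hi * (B\<^sub>G + B\<^sub>\<Omega> + \<gamma> * \<tau>\<^sup>2) \<le> \<beta>"
      \<comment> \<open>With a zero denominator the extended-real quotient is infinite and bounds nothing.\<close>
    proof (cases "B\<^sub>G + B\<^sub>\<Omega> + \<gamma> * \<tau>\<^sup>2 = 0")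
      case True
      then show ?thesis using K(1) by simp
    next
      case False
      with \<epsilon>(3) have "\<epsilon>hi < \<beta> / (B\<^sub>G + B\<^sub>\<Omega> + \<gamma> * \<tau>\<^sup>2)" by simp
      with False cstpos show ?thesis by (simp add: pos_less_divide_eq less_imp_le)
    qed
    moreover have "\<epsilon> k * (B\<^sub>G + B\<^sub>\<Omega> + \<gamma> * \<tau>\<^sup>2) \<le> \<epsilon>hi * (B\<^sub>G + B\<^sub>\<Omega> + \<gamma> * \<tau>\<^sup>2)"
      using \<epsilon>(2) cstpos by (intro mult_right_mono) auto
    ultimately show ?thesis by linarith
  qed
  have q_eq: "q k = vapp_dual_step C \<Theta> \<gamma> (p k) (u k)"
    and p_eq: "p (Suc k) = vapp_dual_step C \<Theta> \<gamma> (p k) (u (Suc k))"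
    and argmin: "is_arg_min (vapp_subproblem G J \<Omega> \<Phi> K (\<epsilon> k) (u k) (q k)) (\<lambda>v. v \<in> U) (u (Suc k))"
    for k
    using vapp unfolding vapp_sequence_def \<Theta>_def by blast+
  have uU: "u k \<in> U" for k
    using vapp by (cases k) (auto simp: vapp_sequence_def is_arg_min_def)
  have qP: "q k \<in> P" for k
    unfolding q_eq vapp_dual_step_def P_def[symmetric]
    using P ps by (intro closest_point_in_set) auto
  define obj_k where "obj_k k w = grad G (u k) \<bullet> w + j w
    + q k \<bullet> (frechet_derivative \<Omega> (at (u k)) w + \<Phi> w) + bregman K w (u k) / \<epsilon> k" for k w
  have sub: "vapp_subproblem G J \<Omega> \<Phi> K (\<epsilon> k) (u k) (q k) w = ereal (obj_k k w)" if "w \<in> V" for k w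
    by (simp add: vapp_subproblem_def obj_k_def J[OF that])
  have le: "vapp_subproblem G J \<Omega> \<Phi> K (\<epsilon> k) (u k) (q k) (u (Suc k))
      \<le> ereal (obj_k k w)" if "w \<in> V" for k w
    using argmin[of k] that VU sub[OF that, of k] by (auto simp: is_arg_min_def not_less)
  \<comment> \<open>A minimiser has a finite subproblem value, since \<open>v0\<close> does.\<close>
  have uV: "u (Suc k) \<in> V" for k
  proof -
    have "vapp_subproblem G J \<Omega> \<Phi> K (\<epsilon> k) (u k) (q k) (u (Suc k)) < \<infinity>"
      using le[OF v0, of k] le_less_trans by fastforce
    then show ?thesis using uU by (auto simp: V_def vapp_subproblem_def)
  qed
  have min: "obj_k k (u (Suc k)) \<le> obj_k k w" if "w \<in> V" for k w
    using le[OF that, of k] sub[OF uV] by simp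
  have iteration: "\<epsilon> k * ((f (u (Suc k)) + y \<bullet> \<Theta> (u (Suc k))) - (f v + q k \<bullet> \<Theta> v))
      \<le> bregman K v (u k) - bregman K v (u (Suc k))
        + \<epsilon> k * ((norm (y - p k))\<^sup>2 / (2 * \<gamma>) - (norm (y - p (Suc k)))\<^sup>2 / (2 * \<gamma>))"
    if "v \<in> V" "y \<in> P" for k v y
    unfolding f_def \<Theta>_def
    by (rule vapp_iteration[where V = V and U = U and C = C and M = "B\<^sub>G" and N = "B\<^sub>\<Omega>" and \<beta> = \<beta> and \<tau> = \<tau>])
      (use j VU K H2 H3 H4 \<Theta>_lip \<epsilon>pos step \<gamma> uU uV that q_eq p_eq min in
        \<open>auto simp: P_def \<Theta>_def obj_k_def\<close>)
  have bregman_nonneg: "0 \<le> bregman K v (u k)" if "v \<in> U" for v k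
  proof -
    have "0 \<le> \<beta> / 2 * (norm (v - u k))\<^sup>2" using K(1) by simp
    also have "\<dots> \<le> bregman K v (u k)"
      using bregman_lower_bound[OF K(2) that uU] K(3) uU by blast
    finally show ?thesis .
  qed
  define R where "R v y = bregman K v (u 0) + \<epsilon> 0 / (2 * \<gamma>) * (norm (y - p 0))\<^sup>2" for v y
  have gap: "(f (ubar t) + y \<bullet> \<Theta> (ubar t)) - (f v + pbar t \<bullet> \<Theta> v) \<le> R v y / (\<epsilon>lo * (real t + 1))"
    if v: "v \<in> V" and y: "y \<in> P" for t v y
  proof -
    have yC: "y \<in> dual_cone C" using y by (simp add: P_def)
    have V: "convex V" using j by (simp add: convex_on_def)
    have "convex_on U (\<lambda>z. y \<bullet> \<Theta> z)"
      using convex_on_add[OF convex_on_inner_cone_convex[OF H3(1) U(3) yC]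
          convex_on_inner_cone_convex[OF H3(2) U(3) yC]]
      by (simp add: \<Theta>_def inner_add_right)
    then have cvx: "convex_on V (\<lambda>z. f z + y \<bullet> \<Theta> z)"
      unfolding f_def using H2(1) VU V by (intro convex_on_add j) (auto intro: convex_on_subset)
    have "(f (ubar t) + y \<bullet> \<Theta> (ubar t)) - (f v + pbar t \<bullet> \<Theta> v)
      \<le> (bregman K v (u 0) + \<epsilon> 0 * ((norm (y - p 0))\<^sup>2 / (2 * \<gamma>))) / (\<epsilon>lo * (real t + 1))"
      unfolding ubar_def pbar_def
      by (rule ergodic_saddle_gap[where V = V and a = "\<lambda>k. bregman K v (u k)"
            and b = "\<lambda>k. (norm (y - p k))\<^sup>2 / (2 * \<gamma>)"])
        (use cvx uV \<epsilon> \<epsilon>lo \<gamma> bregman_nonneg v VU iteration[OF v y] in auto)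
    then show ?thesis by (simp add: R_def)
  qed
  have bdd: "bdd_above (R us ` cball 0 (M\<^sub>0 + 1))"
    unfolding R_def
    by (intro bounded_imp_bdd_above compact_imp_bounded compact_continuous_image continuous_intros) simp
  have d\<^sub>1: "R us y \<le> d\<^sub>1" if "norm y \<le> M\<^sub>0 + 1" for y
    unfolding d\<^sub>1_def R_def[symmetric] using that by (intro cSUP_upper bdd) simp
  show ?thesis
  proof (intro allI impI)
    fix t :: nat
    let ?n = "\<epsilon>lo * (real t + 1)" and ?z = "ubar t"
    have n: "0 < ?n" using \<epsilon>(1) by simp
    have z: "?z \<in> V"
      unfolding ubar_def using j by (intro weighted_mean_in_convex \<epsilon>pos uV) (simp add: convex_on_def)
    have pbar: "pbar t \<in> P"
      unfolding pbar_def by (intro weighted_mean_in_convex P \<epsilon>pos qP)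
    have i: "L ?z y - L v (pbar t) \<le> ereal (R v y / ?n)" if "v \<in> U" "y \<in> P" for v y
    proof (cases "v \<in> V")
      case True
      then show ?thesis using gap[OF True that(2), of t] by (simp add: L[OF z] L[OF True])
    next
      case False
      then have "L v (pbar t) = \<infinity>"
        using that by (simp add: V_def L_def lagrangian_def objective_def)
      then show ?thesis by (simp add: L[OF z])
    qed
    have "f us + pbar t \<bullet> \<Theta> us \<le> f us"
      using saddle_point_cone_value(1)[OF saddle[unfolded L_def P_def[symmetric]] P(2) obj[OF us] pbar]
        L[OF us, of "pbar t"] by (simp add: L_def)
    moreover have "R us y / ?n \<le> d\<^sub>1 / ?n" if "norm y \<le> M\<^sub>0 + 1" for y
      using d\<^sub>1[OF that] n by (simp add: divide_right_mono)
    ultimately have "f ?z + y \<bullet> \<Theta> ?z - f us \<le> d\<^sub>1 / ?n" if "y \<in> P" "norm y \<le> M\<^sub>0 + 1" for y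
      using gap[OF us that(1), of t] that(2) by fastforce
    moreover have "f us \<le> f ?z + ps \<bullet> \<Theta> ?z"
      using saddle_point_cone_value(2)[OF saddle[unfolded L_def P_def[symmetric]] P(2) obj[OF us] subsetD[OF VU z]]
        L[OF z, of ps] by (simp add: L_def)
    ultimately have "norm (closest_point P (\<Theta> ?z)) \<le> d\<^sub>1 / ?n"
      "- (M\<^sub>0 * (d\<^sub>1 / ?n)) \<le> f ?z - f us" "f ?z - f us \<le> d\<^sub>1 / ?n"
      using gap_imp_residual_and_value_bounds[OF P(1,2) ps(2) ps_norm] by blast+
    then show "?z \<in> U \<and> pbar t \<in> dual_cone C \<and>
      (\<forall>v\<in>U. \<forall>y\<in>dual_cone C. L ?z y - L v (pbar t)
        \<le> ereal ((bregman K v (u 0) + \<epsilon> 0 / (2 * \<gamma>) * (norm (y - p 0))\<^sup>2) / ?n)) \<and>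
      norm (closest_point (dual_cone C) (\<Theta> ?z)) \<le> d\<^sub>1 / ?n \<and>
      ereal (- (M\<^sub>0 * d\<^sub>1 / ?n)) \<le> objective G J ?z - objective G J us \<and>
      objective G J ?z - objective G J us \<le> ereal (d\<^sub>1 / ?n)"
      using i pbar z VU by (auto simp: obj[OF z] obj[OF us] P_def R_def)
  qed
qed

end
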